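(* Let $X=\ell_p(\mathbb{Z})$ $(1\le p<\infty)$ or $X=c_0(\mathbb{Z})$. Let $w=(w_n)_{n\in\mathbb{Z}}$ be a bounded sequence of scalars with $\inf_{n\in\mathbb{Z}}|w_n|>0$ and consider the bilateral weighted backward shift $$B_w:(x_n)_{n\in\mathbb{Z}}\in X\mapsto (w_{n+1}x_{n+1})_{n\in\mathbb{Z}}\in X.$$ If $$\lim_{n\to\infty}\sup_{k\in\mathbb{N}}|w_{-k}w_{-k-1}\cdots w_{-k-n}|^{\frac1n}<1\quad\text{and}\quad \lim_{n\to\infty}\inf_{k\in\mathbb{N}}|w_kw_{k+1}\cdots w_{k+n}|^{\frac1n}>1,$$ then $B_w$ satisfies the frequent hypercyclicity criterion.
   Context: $\mathbb{N}$ is the set of positive integers. The scalar field is $\mathbb{R}$ or $\mathbb{C}$. $c_0(\mathbb{Z})$ is the Banach space of scalar sequences $(x_n)_{n\in\mathbb{Z}}$ with $\lim_{|n|\to\infty}x_n=0$, with the supremum norm; $\ell_p(\mathbb{Z})$ is the Banach space of absolutely $p$-summable scalar sequences with the $p$-norm. A bounded linear operator $T$ on a separable Banach space $Y$ satisfies the frequent hypercyclicity criterion if there exist a dense subset $Y_0$ of $Y$ and a map $S:Y_0\to Y_0$ such that for every $y\in Y_0$: (i) $\sum_{k=0}^\infty T^ky$ converges unconditionally; (ii) $\sum_{k=0}^\infty S^ky$ converges unconditionally; (iii) $TSy=y$. *)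

theory Defs
  imports "HOL-Analysis.Analysis" "HOL-Library.Function_Algebras"
begin

text \<open>
  The exponent of \<open>\<ell>\<^sub>p\<close> is a real parameter, so the spaces are not types: a normed space is
  given by a carrier \<open>V\<close> inside an ambient vector space and a norm \<open>N\<close> that is only relevant
  on \<open>V\<close>. Topological notions are those of the library for the metric \<open>N (x - y)\<close> on \<open>V\<close>.
\<close>

locale normed_space_on = vector_space smul
  for smul :: "'k::real_normed_field \<Rightarrow> 'v::ab_group_add \<Rightarrow> 'v" +
  fixes V :: "'v set" and N :: "'v \<Rightarrow> real"
  assumes subspace_carrier: "subspace V"
    and N_nonneg: "x \<in> V \<Longrightarrow> 0 \<le> N x"
    and N_eq_0_iff: "x \<in> V \<Longrightarrow> N x = 0 \<longleftrightarrow> x = 0"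
    and N_scale: "x \<in> V \<Longrightarrow> N (smul c x) = norm c * N x"
    and N_triangle: "x \<in> V \<Longrightarrow> y \<in> V \<Longrightarrow> N (x + y) \<le> N x + N y"

definition norm_dist :: "'v::ab_group_add set \<Rightarrow> ('v \<Rightarrow> real) \<Rightarrow> 'v \<Rightarrow> 'v \<Rightarrow> real" where
  \<comment> \<open>set to 0 off the carrier, because the library's metrics are nonnegative and symmetric everywhere\<close>
  "norm_dist V N x y = (if x \<in> V \<and> y \<in> V then N (x - y) else 0)"

definition norm_topology :: "'v::ab_group_add set \<Rightarrow> ('v \<Rightarrow> real) \<Rightarrow> 'v topology" where
  "norm_topology V N = Metric_space.mtopology V (norm_dist V N)"

definition separable_banach_on ::
  "('k::real_normed_field \<Rightarrow> 'v::ab_group_add \<Rightarrow> 'v) \<Rightarrow> 'v set \<Rightarrow> ('v \<Rightarrow> real) \<Rightarrow> bool" where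
  "separable_banach_on smul V N \<longleftrightarrow>
     normed_space_on smul V N \<and>
     Metric_space.mcomplete V (norm_dist V N) \<and>
     separable_space (norm_topology V N)"

definition bounded_operator_on ::
  "('k::real_normed_field \<Rightarrow> 'v::ab_group_add \<Rightarrow> 'v) \<Rightarrow> 'v set \<Rightarrow> ('v \<Rightarrow> real) \<Rightarrow> ('v \<Rightarrow> 'v) \<Rightarrow> bool" where
  "bounded_operator_on smul V N T \<longleftrightarrow>
     T \<in> V \<rightarrow> V \<and>
     (\<forall>x\<in>V. \<forall>y\<in>V. T (x + y) = T x + T y) \<and>
     (\<forall>c. \<forall>x\<in>V. T (smul c x) = smul c (T x)) \<and>
     (\<exists>C. \<forall>x\<in>V. N (T x) \<le> C * N x)"

text \<open>Unconditional convergence: every rearrangement of the series converges in norm.\<close>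

definition unconditionally_convergent ::
  "'v::ab_group_add set \<Rightarrow> ('v \<Rightarrow> real) \<Rightarrow> (nat \<Rightarrow> 'v) \<Rightarrow> bool" where
  "unconditionally_convergent V N f \<longleftrightarrow>
     (\<forall>\<pi>. bij \<pi> \<longrightarrow>
       (\<exists>s. limitin (norm_topology V N) (\<lambda>n. \<Sum>k<n. f (\<pi> k)) s sequentially))"

definition frequent_hypercyclicity_criterion ::
  "('k::real_normed_field \<Rightarrow> 'v::ab_group_add \<Rightarrow> 'v) \<Rightarrow> 'v set \<Rightarrow> ('v \<Rightarrow> real) \<Rightarrow> ('v \<Rightarrow> 'v) \<Rightarrow> bool" where
  "frequent_hypercyclicity_criterion smul V N T \<longleftrightarrow>
     separable_banach_on smul V N \<and>
     bounded_operator_on smul V N T \<and>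
     (\<exists>Y\<^sub>0 S. Y\<^sub>0 \<subseteq> V \<and> norm_topology V N closure_of Y\<^sub>0 = V \<and> S \<in> Y\<^sub>0 \<rightarrow> Y\<^sub>0 \<and>
       (\<forall>y\<in>Y\<^sub>0.
          unconditionally_convergent V N (\<lambda>k. (T ^^ k) y) \<and>
          unconditionally_convergent V N (\<lambda>k. (S ^^ k) y) \<and>
          T (S y) = y))"

definition seq_scale :: "'a::times \<Rightarrow> (int \<Rightarrow> 'a) \<Rightarrow> (int \<Rightarrow> 'a)" where
  "seq_scale c x = (\<lambda>n. c * x n)"

definition lp_space :: "real \<Rightarrow> (int \<Rightarrow> 'a::real_normed_field) set" where
  "lp_space p = {x. (\<lambda>n. norm (x n) powr p) summable_on UNIV}"

definition lp_norm :: "real \<Rightarrow> (int \<Rightarrow> 'a::real_normed_field) \<Rightarrow> real" where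
  "lp_norm p x = (\<Sum>\<^sub>\<infinity>n. norm (x n) powr p) powr (1 / p)"

definition c0_space :: "(int \<Rightarrow> 'a::real_normed_field) set" where
  "c0_space = {x. (x \<longlongrightarrow> 0) (filtercomap abs at_top)}"

definition c0_norm :: "(int \<Rightarrow> 'a::real_normed_field) \<Rightarrow> real" where
  "c0_norm x = (SUP n. norm (x n))"

definition backward_shift :: "(int \<Rightarrow> 'a::times) \<Rightarrow> (int \<Rightarrow> 'a) \<Rightarrow> (int \<Rightarrow> 'a)" where
  "backward_shift w x = (\<lambda>n. w (n + 1) * x (n + 1))"

end

theory Submission
  imports Defs
begin

text \<open>
  Take \<open>Y\<^sub>0\<close> to be the finitely supported sequences and \<open>S\<close> the weighted forward shift
  inverting \<open>B\<^sub>w\<close>. The norms of \<open>B\<^sub>w\<^sup>k e\<^sub>m\<close> and \<open>S\<^sup>k e\<^sub>m\<close> are products of \<open>k\<close> consecutive weights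
  to the left of \<open>m\<close>, respectively of inverse weights to its right. Changing \<open>m\<close> only multiplies
  such products by a constant and shifts the index, so it is enough to bound them for one \<open>m\<close>; there
  the root test, applied to the term \<open>k = 1\<close> of the supremum or infimum, gives absolute
  convergence, hence unconditional convergence.
\<close>

subsection \<open>Normed spaces on a carrier\<close>

context normed_space_on
begin

lemma zero_mem: "0 \<in> V"
  and add_mem: "x \<in> V \<Longrightarrow> y \<in> V \<Longrightarrow> x + y \<in> V"
  and scale_mem: "x \<in> V \<Longrightarrow> smul c x \<in> V"
  and diff_mem: "x \<in> V \<Longrightarrow> y \<in> V \<Longrightarrow> x - y \<in> V"
  and sum_mem: "(\<And>i. i \<in> I \<Longrightarrow> f i \<in> V) \<Longrightarrow> sum f I \<in> V"
  using subspace_0[OF subspace_carrier] subspace_add[OF subspace_carrier]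
    subspace_scale[OF subspace_carrier] subspace_diff[OF subspace_carrier]
    subspace_sum[OF subspace_carrier, of I f] by auto

lemma N_zero: "N 0 = 0"
  using N_eq_0_iff zero_mem by blast

lemma N_minus_commute:
  assumes "x \<in> V" "y \<in> V"
  shows "N (x - y) = N (y - x)"
proof -
  have "smul (-1) (y - x) = x - y"
    using scale_minus_left[of 1 "y - x"] by (simp only: scale_one minus_diff_eq)
  moreover have "N (smul (-1) (y - x)) = N (y - x)"
    using assms by (simp only: N_scale diff_mem) simp
  ultimately show ?thesis by simp
qed

lemma N_diff_triangle:
  assumes "x \<in> V" "y \<in> V" "z \<in> V"
  shows "N (x - z) \<le> N (x - y) + N (y - z)"
  using N_triangle[of "x - y" "y - z"] assms by (simp add: diff_mem)

lemma N_sum_le: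
  assumes "finite I" "\<And>i. i \<in> I \<Longrightarrow> f i \<in> V"
  shows "N (sum f I) \<le> (\<Sum>i\<in>I. N (f i))"
  using assms
proof (induction rule: finite_induct)
  case empty
  then show ?case by (simp add: N_zero)
next
  case (insert i I)
  then have "N (f i + sum f I) \<le> N (f i) + N (sum f I)"
    by (intro N_triangle sum_mem) auto
  with insert show ?case by fastforce
qed

sublocale Metric_space V "norm_dist V N"
proof
  show "0 \<le> norm_dist V N x y" for x y
    by (simp add: norm_dist_def N_nonneg diff_mem)
  show "norm_dist V N x y = norm_dist V N y x" for x y
    by (simp add: norm_dist_def N_minus_commute)
  show "(norm_dist V N x y = 0) = (x = y)" if "x \<in> V" "y \<in> V" for x y
    using that N_eq_0_iff[of "x - y"] by (simp add: norm_dist_def diff_mem)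
  show "norm_dist V N x z \<le> norm_dist V N x y + norm_dist V N y z"
    if "x \<in> V" "y \<in> V" "z \<in> V" for x y z
    using that N_diff_triangle by (simp add: norm_dist_def)
qed

lemma norm_topology_eq: "norm_topology V N = mtopology"
  by (simp add: norm_topology_def)

lemma closure_eq_carrierI:
  assumes "S \<subseteq> V" "\<And>x e. x \<in> V \<Longrightarrow> 0 < e \<Longrightarrow> \<exists>y\<in>S. N (x - y) < e"
  shows "norm_topology V N closure_of S = V"
  using assms unfolding norm_topology_eq metric_closure_of
  by (fastforce simp: norm_dist_def)

text \<open>Restates completeness through \<open>N\<close> alone, so that a concrete space does not
  have to deal with the default value of \<open>norm_dist\<close> off the carrier.\<close>

lemma mcompleteI:
  assumes "\<And>X :: nat \<Rightarrow> _. range X \<subseteq> V \<Longrightarrow> (\<And>e. 0 < e \<Longrightarrow> \<exists>K. \<forall>i\<ge>K. \<forall>j\<ge>K. N (X i - X j) < e)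
     \<Longrightarrow> \<exists>x\<in>V. \<forall>e>0. \<exists>K. \<forall>i\<ge>K. N (X i - x) < e"
  shows "mcomplete"
  unfolding mcomplete_def
proof (intro allI impI)
  fix X assume X: "MCauchy X"
  then have XV: "range X \<subseteq> V" by (simp add: MCauchy_def)
  then have XV': "X i \<in> V" for i by auto
  have "\<exists>K. \<forall>i\<ge>K. \<forall>j\<ge>K. N (X i - X j) < e" if "0 < e" for e
    using X that unfolding MCauchy_def norm_dist_def by (simp add: XV')
  with XV have "\<exists>x\<in>V. \<forall>e>0. \<exists>K. \<forall>i\<ge>K. N (X i - x) < e"
    by (rule assms)
  then show "\<exists>x. limitin mtopology X x sequentially"
    unfolding limit_metric_sequentially norm_dist_def using XV' by auto
qed

text \<open>In a complete space, absolute convergence forces unconditional convergence, since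
  absolute convergence of a real series is preserved by rearrangement.\<close>

lemma unconditionally_convergentI:
  assumes "mcomplete" and mem: "\<And>k. f k \<in> V" and sm: "summable (\<lambda>k. N (f k))"
  shows "unconditionally_convergent V N f"
  unfolding unconditionally_convergent_def
proof (intro allI impI)
  fix \<pi> :: "nat \<Rightarrow> nat" assume "bij \<pi>"
  \<comment> \<open>\<open>summable_on\<close> refers to no order of summation, so
    \<open>\<pi>\<close> acts by mere reindexing; nonnegativity of the terms links it to
    \<open>summable\<close>.\<close>
  have "(\<lambda>k. N (f k)) summable_on UNIV"
    using sm by (simp add: summable_on_UNIV_nonneg_real_iff N_nonneg mem)
  then have "(\<lambda>k. N (f (\<pi> k))) summable_on UNIV"
    using summable_on_reindex_bij_betw[of \<pi> UNIV UNIV "\<lambda>k. N (f k)"] \<open>bij \<pi>\<close> by simp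
  then have "summable (\<lambda>k. N (f (\<pi> k)))"
    by (simp add: summable_on_UNIV_nonneg_real_iff N_nonneg mem)
  then have C: "\<exists>K. \<forall>m\<ge>K. \<forall>n. norm (\<Sum>k=m..<n. N (f (\<pi> k))) < e" if "0 < e" for e
    using that unfolding summable_Cauchy by blast
  define X where "X n = (\<Sum>k<n. f (\<pi> k))" for n
  have XV: "X n \<in> V" for n by (simp add: X_def sum_mem mem)
  have le: "N (X n - X m) < e" if mn: "m \<le> n" and "norm (\<Sum>k=m..<n. N (f (\<pi> k))) < e" for m n e
  proof -
    have "X n - X m = (\<Sum>k=m..<n. f (\<pi> k))"
      using sum_diff_nat_ivl[of 0 m n "\<lambda>k. f (\<pi> k)"] mn by (simp add: X_def lessThan_atLeast0)
    also have "N \<dots> \<le> (\<Sum>k=m..<n. N (f (\<pi> k)))"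
      by (intro N_sum_le mem) auto
    finally show ?thesis using that by simp
  qed
  have "MCauchy X"
    unfolding MCauchy_def
  proof (intro conjI allI impI)
    fix e :: real assume "0 < e"
    then obtain K where K: "\<And>m n. m \<ge> K \<Longrightarrow> norm (\<Sum>k=m..<n. N (f (\<pi> k))) < e"
      using C by blast
    have "N (X i - X j) < e" if "K \<le> i" "K \<le> j" for i j
      using le[of i j e] le[of j i e] K that N_minus_commute[OF XV XV, of i j]
      by (cases "i \<le> j") auto
    then show "\<exists>K. \<forall>i j. K \<le> i \<longrightarrow> K \<le> j \<longrightarrow> norm_dist V N (X i) (X j) < e"
      unfolding norm_dist_def using XV by auto
  qed (use XV in auto)
  then show "\<exists>s. limitin (norm_topology V N) (\<lambda>n. \<Sum>k<n. f (\<pi> k)) s sequentially"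
    using \<open>mcomplete\<close> unfolding mcomplete_def norm_topology_eq X_def by blast
qed

end

subsection \<open>Solid sequence spaces\<close>

definition restrict_seq :: "int set \<Rightarrow> (int \<Rightarrow> 'a::zero) \<Rightarrow> int \<Rightarrow> 'a" where
  "restrict_seq F x = (\<lambda>n. if n \<in> F then x n else 0)"

definition finite_support :: "(int \<Rightarrow> 'a::zero) set" where
  "finite_support = {x. finite {n. x n \<noteq> 0}}"

definition unit_seq :: "int \<Rightarrow> int \<Rightarrow> 'a::zero_neq_one" where
  "unit_seq m = (\<lambda>n. if n = m then 1 else 0)"

text \<open>The features shared by \<open>\<ell>\<^sub>p\<close> and \<open>c\<^sub>0\<close>. The last assumption is a closedness property under
  pointwise limits that stays true in \<open>c\<^sub>0\<close>, where the Fatou property fails.\<close>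

locale solid_sequence_space = normed_space_on seq_scale V N
  for V :: "(int \<Rightarrow> 'a::{real_normed_field, euclidean_space}) set" and N +
  assumes solid_mem: "x \<in> V \<Longrightarrow> (\<And>n. norm (y n) \<le> norm (x n)) \<Longrightarrow> y \<in> V"
    and solid_le: "x \<in> V \<Longrightarrow> (\<And>n. norm (y n) \<le> norm (x n)) \<Longrightarrow> N y \<le> N x"
    and unit_mem: "unit_seq m \<in> V"
    and N_unit: "N (unit_seq m) = 1"
    and translate_mem: "x \<in> V \<Longrightarrow> (\<lambda>n. x (n + 1)) \<in> V"
    and N_translate: "x \<in> V \<Longrightarrow> N (\<lambda>n. x (n + 1)) = N x"
    and small_tail: "x \<in> V \<Longrightarrow> 0 < e \<Longrightarrow> \<exists>F. finite F \<and> N (restrict_seq (- F) x) < e"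
    and closed_mem:
      "(\<And>e. 0 < e \<Longrightarrow> \<exists>y\<in>V. \<forall>F. finite F \<longrightarrow> N (restrict_seq F (x - y)) \<le> e) \<Longrightarrow> x \<in> V"
begin

section \<open>Coordinates and finitely supported sequences\<close>

lemma restrict_mem: "x \<in> V \<Longrightarrow> restrict_seq F x \<in> V"
  by (rule solid_mem[of x]) (auto simp: restrict_seq_def)

text \<open>Solidity, applied to the single term \<open>x n\<close> times \<open>unit_seq n\<close>.
  Hence Cauchy sequences for \<open>N\<close> are Cauchy in each coordinate.\<close>

lemma norm_coord_le:
  assumes "x \<in> V"
  shows "norm (x n) \<le> N x"
proof -
  have "N (seq_scale (x n) (unit_seq n)) \<le> N x"
    by (rule solid_le[OF assms]) (auto simp: seq_scale_def unit_seq_def)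
  then show ?thesis by (simp add: N_scale unit_mem N_unit)
qed

text \<open>Expand \<open>x\<close> in unit sequences, which have norm 1. This crude estimate by the
  sum of the coordinates serves for every solid space at once, whatever the formula for
  \<open>N\<close>.\<close>

lemma finite_support_mem_le:
  assumes "finite F" "\<And>n. n \<notin> F \<Longrightarrow> x n = 0"
  shows "x \<in> V \<and> N x \<le> (\<Sum>n\<in>F. norm (x n))"
proof -
  have "x = (\<Sum>m\<in>F. seq_scale (x m) (unit_seq m))"
  proof
    fix n
    have "(\<Sum>m\<in>F. seq_scale (x m) (unit_seq m)) n = (\<Sum>m\<in>F. seq_scale (x m) (unit_seq m) n)"
      using assms(1) by (induction rule: finite_induct) auto
    also have "\<dots> = (\<Sum>m\<in>F. if m = n then x n else 0)"
      by (intro sum.cong) (auto simp: seq_scale_def unit_seq_def)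
    also have "\<dots> = x n" using assms by auto
    finally show "x n = (\<Sum>m\<in>F. seq_scale (x m) (unit_seq m)) n" by simp
  qed
  moreover have "(\<Sum>m\<in>F. seq_scale (x m) (unit_seq m)) \<in> V"
    by (intro sum_mem scale_mem unit_mem)
  moreover have "N (\<Sum>m\<in>F. seq_scale (x m) (unit_seq m)) \<le> (\<Sum>n\<in>F. norm (x n))"
    using N_sum_le[OF assms(1), of "\<lambda>m. seq_scale (x m) (unit_seq m)"]
    by (simp add: N_scale scale_mem unit_mem N_unit)
  ultimately show ?thesis by simp
qed

lemma finite_support_subset: "finite_support \<subseteq> V"
  using finite_support_mem_le unfolding finite_support_def by fastforce

text \<open>The part of \<open>x\<close> outside a suitable finite set has norm below any given
  \<open>e\<close>, so bounds on finite sections pass to \<open>x\<close>.\<close>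

lemma N_le_of_restrict:
  assumes x: "x \<in> V" and C: "\<And>F. finite F \<Longrightarrow> N (restrict_seq F x) \<le> C"
  shows "N x \<le> C"
proof (rule field_le_epsilon)
  fix e :: real assume "0 < e"
  then obtain F where F: "finite F" "N (restrict_seq (- F) x) < e"
    using small_tail x by blast
  have "x = restrict_seq F x + restrict_seq (- F) x"
    by (auto simp: restrict_seq_def fun_eq_iff)
  then have "N x \<le> N (restrict_seq F x) + N (restrict_seq (- F) x)"
    using N_triangle[OF restrict_mem restrict_mem] x by metis
  with C[OF F(1)] F(2) show "N x \<le> C + e" by linarith
qed

text \<open>The coordinatewise limit \<open>x\<close> is the candidate. Until \<open>x\<close> is
  known to lie in \<open>V\<close>, only finite sections of \<open>x - X i\<close> are estimated;
  \<open>closed_mem\<close> then gives membership and \<open>N_le_of_restrict\<close> removes the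
  restriction.\<close>

lemma complete: "mcomplete"
proof (rule mcompleteI)
  fix X :: "nat \<Rightarrow> int \<Rightarrow> 'a"
  assume "range X \<subseteq> V"
    and Cau: "\<And>e. 0 < e \<Longrightarrow> \<exists>K. \<forall>i\<ge>K. \<forall>j\<ge>K. N (X i - X j) < e"
  then have XV: "X i \<in> V" for i by auto
  have "Cauchy (\<lambda>i. X i n)" for n
    unfolding Cauchy_def dist_norm
  proof (intro allI impI)
    fix e :: real assume "0 < e"
    then obtain K where K: "\<forall>i\<ge>K. \<forall>j\<ge>K. N (X i - X j) < e" using Cau by blast
    have "norm (X i n - X j n) \<le> N (X i - X j)" for i j
      using norm_coord_le[OF diff_mem[OF XV XV], of i j n] by simp
    with K show "\<exists>K. \<forall>i\<ge>K. \<forall>j\<ge>K. norm (X i n - X j n) < e"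
      using le_less_trans by blast
  qed
  then have "\<exists>l. (\<lambda>i. X i n) \<longlonglongrightarrow> l" for n
    by (simp add: Cauchy_convergent_iff convergent_def)
  then obtain x where lim: "\<And>n. (\<lambda>i. X i n) \<longlonglongrightarrow> x n" by metis
  have restr: "\<exists>K. \<forall>i\<ge>K. \<forall>F. finite F \<longrightarrow> N (restrict_seq F (x - X i)) \<le> e" if e: "0 < e" for e
  proof -
    obtain K where K: "\<forall>i\<ge>K. \<forall>j\<ge>K. N (X i - X j) < e" using Cau e by blast
    \<comment> \<open>Insert a later term \<open>X j\<close>: the Cauchy property bounds
      \<open>X j - X i\<close> by \<open>e\<close>, while the distance from \<open>X j\<close> to
      \<open>x\<close> on the finite set \<open>F\<close> vanishes as \<open>j\<close>
      grows.\<close>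
    have "N (restrict_seq F (x - X i)) \<le> e" if F: "finite F" and i: "i \<ge> K" for F i
    proof (rule tendsto_lowerbound[where F = sequentially])
      show "(\<lambda>j. (\<Sum>n\<in>F. norm (x n - X j n)) + e) \<longlonglongrightarrow> e"
        by (rule tendsto_eq_intros lim refl tendsto_norm | simp)+
      show "\<forall>\<^sub>F j in sequentially. N (restrict_seq F (x - X i)) \<le> (\<Sum>n\<in>F. norm (x n - X j n)) + e"
        using eventually_ge_at_top[of K]
      proof eventually_elim
        case (elim j)
        let ?u = "restrict_seq F (x - X j)" and ?v = "restrict_seq F (X j - X i)"
        have u: "?u \<in> V \<and> N ?u \<le> (\<Sum>n\<in>F. norm (?u n))"
          by (intro finite_support_mem_le F) (auto simp: restrict_seq_def)
        have "(\<Sum>n\<in>F. norm (?u n)) = (\<Sum>n\<in>F. norm (x n - X j n))"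
          by (intro sum.cong) (auto simp: restrict_seq_def)
        moreover have "N ?v \<le> N (X j - X i)"
          by (intro solid_le diff_mem XV) (auto simp: restrict_seq_def)
        moreover have "N (X j - X i) < e" using K elim i by blast
        moreover have "restrict_seq F (x - X i) = ?u + ?v"
          by (auto simp: restrict_seq_def fun_eq_iff)
        moreover have "N (?u + ?v) \<le> N ?u + N ?v"
          using u by (intro N_triangle) (auto intro: restrict_mem diff_mem XV)
        ultimately show ?case using u by simp
      qed
    qed simp
    then show ?thesis by blast
  qed
  have xV: "x \<in> V"
  proof (rule closed_mem)
    fix e :: real assume "0 < e"
    from restr[OF this] show "\<exists>y\<in>V. \<forall>F. finite F \<longrightarrow> N (restrict_seq F (x - y)) \<le> e"
      using XV by blast
  qed
  moreover have "\<exists>K. \<forall>i\<ge>K. N (X i - x) < e" if e: "0 < e" for e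
  proof -
    have "0 < e / 2" using e by simp
    from restr[OF this] obtain K where "\<forall>i\<ge>K. \<forall>F. finite F \<longrightarrow> N (restrict_seq F (x - X i)) \<le> e / 2"
      by blast
    then have "N (x - X i) \<le> e / 2" if "i \<ge> K" for i
      using that by (blast intro: N_le_of_restrict[OF diff_mem[OF xV XV]])
    then show ?thesis
      using e N_minus_commute[OF xV XV] by (intro exI[of _ K]) (fastforce simp: field_simps)
  qed
  ultimately show "\<exists>x\<in>V. \<forall>e>0. \<exists>K. \<forall>i\<ge>K. N (X i - x) < e" by blast
qed

text \<open>Cut off a tail of norm below \<open>e / 2\<close>, then move the finitely many remaining
  coordinates into the dense set \<open>D\<close>. Taking \<open>D = UNIV\<close> gives density of
  \<open>finite_support\<close>; a countable \<open>D\<close> gives separability.\<close>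

lemma finite_support_approx:
  assumes x: "x \<in> V" and e: "0 < e"
    and D: "\<And>U. open U \<Longrightarrow> U \<noteq> {} \<Longrightarrow> \<exists>d\<in>D. d \<in> U"
  shows "\<exists>F y. finite F \<and> (\<forall>n\<in>F. y n \<in> D) \<and> (\<forall>n. n \<notin> F \<longrightarrow> y n = 0) \<and> y \<in> V \<and> N (x - y) < e"
proof -
  obtain F where F: "finite F" "N (restrict_seq (- F) x) < e / 2"
    using small_tail[OF x, of "e / 2"] e by auto
  \<comment> \<open>Errors below \<open>\<delta>\<close> in \<open>card F\<close> coordinates add up
    to at most \<open>e / 2\<close>; the summand 1 keeps \<open>\<delta>\<close> positive when
    \<open>F\<close> is empty.\<close>
  define \<delta> where "\<delta> = e / (2 * (real (card F) + 1))"
  have \<delta>: "\<delta> > 0" using e by (simp add: \<delta>_def)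
  have "\<exists>d\<in>D. d \<in> ball (x n) \<delta>" for n
    using \<delta> by (intro D) auto
  then obtain g where g: "\<And>n. g n \<in> D" "\<And>n. norm (x n - g n) < \<delta>"
    unfolding mem_ball dist_norm by metis
  define y where "y = restrict_seq F g"
  let ?u = "restrict_seq F (x - y)"
  have y: "y \<in> V"
    using finite_support_mem_le[OF F(1), of y] by (simp add: y_def restrict_seq_def)
  have u: "?u \<in> V" "N ?u \<le> (\<Sum>n\<in>F. norm (?u n))"
    using finite_support_mem_le[OF F(1), of ?u] by (simp_all add: restrict_seq_def)
  have "(\<Sum>n\<in>F. norm (?u n)) \<le> (\<Sum>n\<in>F. \<delta>)"
    using g(2) by (intro sum_mono) (auto simp: restrict_seq_def y_def less_imp_le)
  also have "\<dots> \<le> e / 2"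
    using e by (simp add: \<delta>_def field_simps)
  finally have "N ?u \<le> e / 2" using u by simp
  moreover have "x - y = ?u + restrict_seq (- F) x"
    by (auto simp: restrict_seq_def fun_eq_iff y_def)
  moreover have "N (?u + restrict_seq (- F) x) \<le> N ?u + N (restrict_seq (- F) x)"
    by (intro N_triangle u restrict_mem x)
  ultimately have "N (x - y) < e" using F(2) by simp
  moreover have "(\<forall>n\<in>F. y n \<in> D) \<and> (\<forall>n. n \<notin> F \<longrightarrow> y n = 0)"
    using g(1) by (simp add: y_def restrict_seq_def)
  ultimately show ?thesis using F(1) y by blast
qed

lemma finite_support_dense: "norm_topology V N closure_of finite_support = V"
proof (rule closure_eq_carrierI[OF finite_support_subset])
  fix x :: "int \<Rightarrow> 'a" and e :: real assume "x \<in> V" "0 < e"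
  then obtain F y where "finite F" "\<forall>n. n \<notin> F \<longrightarrow> y n = 0" "N (x - y) < e"
    using finite_support_approx[of x e UNIV] by blast
  moreover from this have "y \<in> finite_support"
    unfolding finite_support_def by (auto elim!: rev_finite_subset)
  ultimately show "\<exists>y\<in>finite_support. N (x - y) < e" by blast
qed

lemma separable: "separable_space (norm_topology V N)"
proof -
  obtain D :: "'a set" where D: "countable D"
    "\<And>U. open U \<Longrightarrow> U \<noteq> {} \<Longrightarrow> \<exists>d\<in>D. d \<in> U"
    using countable_dense_setE by blast
  \<comment> \<open>\<open>PiE\<close> fixes the value outside \<open>F\<close>, so each set of
    choices is countable; \<open>restrict_seq\<close> then replaces that value by 0. Intersecting
    with \<open>V\<close> makes \<open>Q\<close> a subset of the carrier by definition.\<close>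
  define Q where
    "Q = (\<Union>F\<in>{F :: int set. finite F}. restrict_seq F ` (PiE F (\<lambda>_. D))) \<inter> V"
  have "countable (PiE F (\<lambda>_. D))" if "finite F" for F :: "int set"
    using that D(1) by (intro countable_PiE) auto
  then have "countable Q"
    unfolding Q_def by (intro countable_Int1 countable_UN countable_image) (auto simp: countable_Collect_finite)
  moreover have "norm_topology V N closure_of Q = V"
  proof (rule closure_eq_carrierI)
    fix x :: "int \<Rightarrow> 'a" and e :: real assume "x \<in> V" "0 < e"
    from finite_support_approx[OF this D(2)]
    obtain F y where y: "finite F" "\<forall>n\<in>F. y n \<in> D" "\<forall>n. n \<notin> F \<longrightarrow> y n = 0" "y \<in> V" "N (x - y) < e"
      by blast
    have "y = restrict_seq F (restrict y F)"
      using y(3) by (auto simp: restrict_seq_def fun_eq_iff)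
    moreover have "restrict y F \<in> PiE F (\<lambda>_. D)" using y(2) by auto
    ultimately have "y \<in> Q" using y unfolding Q_def by blast
    with y(5) show "\<exists>y\<in>Q. N (x - y) < e" by blast
  qed (simp add: Q_def)
  ultimately show ?thesis
    unfolding separable_space_def norm_topology_eq topspace_mtopology
    by (metis Q_def inf_le2)
qed

lemma separable_banach: "separable_banach_on seq_scale V N"
  unfolding separable_banach_on_def using normed_space_on_axioms complete separable by blast

end

subsection \<open>Weighted shifts\<close>

lemma summable_prod_translate:
  fixes v :: "int \<Rightarrow> real"
  assumes nz: "\<And>n. v n \<noteq> 0" and "summable (\<lambda>k. \<Prod>i<k. v (m\<^sub>0 + int i))"
  shows "summable (\<lambda>k. \<Prod>i<k. v (m + int i))"
proof -
  \<comment> \<open>Splitting off the first factor \<open>v m\<close> leaves the product that starts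
    at \<open>m + 1\<close>, with one factor fewer.\<close>
  have step: "summable (\<lambda>k. \<Prod>i<k. v (m + int i)) \<longleftrightarrow> summable (\<lambda>k. \<Prod>i<k. v (m + 1 + int i))" for m
  proof -
    have "summable (\<lambda>k. \<Prod>i<k. v (m + int i)) \<longleftrightarrow> summable (\<lambda>k. \<Prod>i<Suc k. v (m + int i))"
      by (rule summable_Suc_iff[symmetric])
    also have "(\<lambda>k. \<Prod>i<Suc k. v (m + int i)) = (\<lambda>k. v m * (\<Prod>i<k. v (m + 1 + int i)))"
      by (simp only: prod.lessThan_Suc_shift) (simp add: algebra_simps)
    also have "summable \<dots> \<longleftrightarrow> summable (\<lambda>k. \<Prod>i<k. v (m + 1 + int i))"
      using nz by (simp add: summable_cmult_iff)
    finally show ?thesis .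
  qed
  \<comment> \<open>The induction runs upwards and downwards from \<open>m\<^sub>0\<close>, using
    both directions of \<open>step\<close>.\<close>
  show ?thesis
    by (induction m rule: int_induct[of _ m\<^sub>0]) (use assms(2) step[of "_ - 1"] step in auto)
qed

text \<open>Root test for roots that are merely dominated by a convergent sequence, as one term is
  by the supremum over \<open>k\<close>.\<close>

lemma summable_of_root_limit_less_1:
  fixes a :: "nat \<Rightarrow> real"
  assumes "\<And>n. 0 \<le> a n" and le: "\<forall>\<^sub>F n in sequentially. a n powr (1 / real n) \<le> b n"
    and "b \<longlonglongrightarrow> L" "L < 1"
  shows "summable a"
proof -
  obtain r where r: "L < r" "r < 1" using \<open>L < 1\<close> dense by blast
  \<comment> \<open>The maximum with 1/2 provides a positive ratio without first proving
    \<open>0 \<le> L\<close>.\<close>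
  have "0 < max r (1/2)" "max r (1/2) < 1" using r by auto
  show ?thesis
  proof (rule summable_comparison_test_ev)
    show "summable (\<lambda>n. max r (1/2) ^ n)" using r by (intro summable_geometric) auto
    have "\<forall>\<^sub>F n in sequentially. b n < r" using assms(3) r(1) by (rule order_tendstoD)
    \<comment> \<open>Restricting to \<open>n > 0\<close> matters: only then does raising
      \<open>a n powr (1 / real n)\<close> to the power \<open>n\<close> recover
      \<open>a n\<close>.\<close>
    then show "\<forall>\<^sub>F n in sequentially. norm (a n) \<le> max r (1/2) ^ n"
      using eventually_gt_at_top[of 0] le
    proof eventually_elim
      case (elim n)
      have "a n powr (1 / real n) \<le> max r (1/2)" using elim by linarith
      then have "(a n powr (1 / real n)) powr n \<le> max r (1/2) powr n"
        by (intro powr_mono2) auto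
      then have "a n \<le> max r (1/2) ^ n"
        using elim assms(1)[of n] by (simp add: powr_powr powr_realpow)
      then show ?case using assms(1)[of n] by simp
    qed
  qed
qed

text \<open>Pass to inverses in the root test. The comparison can be inverted once
  \<open>b n\<close> exceeds 1, which is why that test asks for it only eventually.\<close>

lemma summable_inverse_of_root_limit_greater_1:
  fixes a :: "nat \<Rightarrow> real"
  assumes "\<And>n. 0 \<le> a n" and le: "\<And>n. b n \<le> a n powr (1 / real n)" and "b \<longlonglongrightarrow> L" "1 < L"
  shows "summable (\<lambda>n. inverse (a n))"
proof (rule summable_of_root_limit_less_1)
  show "(\<lambda>n. inverse (b n)) \<longlonglongrightarrow> inverse L"
    using assms by (intro tendsto_inverse) auto
  have "\<forall>\<^sub>F n in sequentially. 1 < b n"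
    using assms(3,4) by (rule order_tendstoD)
  then show "\<forall>\<^sub>F n in sequentially. inverse (a n) powr (1 / real n) \<le> inverse (b n)"
  proof eventually_elim
    case (elim n)
    then show ?case
      using le[of n] by (simp add: inverse_powr le_imp_inverse_le)
  qed
qed (use assms in \<open>auto simp: field_simps\<close>)

section \<open>Iterates of the two shifts\<close>

definition forward_shift :: "(int \<Rightarrow> 'a::field) \<Rightarrow> (int \<Rightarrow> 'a) \<Rightarrow> int \<Rightarrow> 'a" where
  "forward_shift w x = (\<lambda>n. x (n - 1) / w n)"

text \<open>Indexed by the source coordinate \<open>m\<close>, which travels to
  \<open>m - k\<close>; thus the coefficient is a product starting at the fixed place
  \<open>m\<close>.\<close>

lemma backward_shift_funpow:
  fixes w :: "int \<Rightarrow> 'a::comm_ring_1"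
  shows "(backward_shift w ^^ k) x (m - int k) = (\<Prod>i<k. w (m - int i)) * x m"
proof (induction k arbitrary: m)
  case (Suc k)
  have "(backward_shift w ^^ Suc k) x (m - int (Suc k))
      = w (m - int k) * (backward_shift w ^^ k) x (m - int k)"
    by (simp add: backward_shift_def algebra_simps)
  with Suc show ?case by (simp add: algebra_simps)
qed simp

text \<open>The factors start at \<open>m + 1\<close>, since the first step moves coordinate
  \<open>m\<close> to \<open>m + 1\<close> and divides by the weight there.\<close>

lemma forward_shift_funpow:
  fixes w :: "int \<Rightarrow> 'a::field"
  shows "(forward_shift w ^^ k) x (m + int k) = (\<Prod>i<k. inverse (w (m + 1 + int i))) * x m"
proof (induction k arbitrary: m)
  case (Suc k)
  have "(forward_shift w ^^ Suc k) x (m + int (Suc k))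
      = inverse (w (m + 1 + int k)) * (forward_shift w ^^ k) x (m + int k)"
    by (simp add: forward_shift_def algebra_simps divide_inverse)
  with Suc show ?case by (simp add: algebra_simps)
qed simp

lemma forward_shift_finite_support:
  assumes "x \<in> finite_support"
  shows "forward_shift w x \<in> finite_support"
proof -
  have "{n. forward_shift w x n \<noteq> 0} \<subseteq> (\<lambda>n. n + 1) ` {n. x n \<noteq> 0}"
    by (auto simp: forward_shift_def image_iff intro!: exI[of _ "_ - 1"])
  with assms show ?thesis
    unfolding finite_support_def by (blast intro: finite_subset)
qed

section \<open>The criterion in an arbitrary solid sequence space\<close>

context solid_sequence_space
begin

text \<open>The image is dominated coordinatewise by \<open>C\<close> times the translate of
  \<open>x\<close>, and translation preserves \<open>N\<close>.\<close>

lemma bounded_operator_backward_shift: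
  assumes "bounded (range w)"
  shows "bounded_operator_on seq_scale V N (backward_shift w)"
proof -
  obtain C where C: "0 < C" "\<And>n. norm (w n) \<le> C"
    using assms unfolding bounded_pos by auto
  have "backward_shift w x \<in> V \<and> N (backward_shift w x) \<le> C * N x" if x: "x \<in> V" for x
  proof -
    let ?y = "seq_scale (of_real C) (\<lambda>n. x (n + 1))"
    have y: "?y \<in> V" "N ?y = C * N x"
      using x C(1) by (simp_all add: scale_mem translate_mem N_scale N_translate)
    have "norm (backward_shift w x n) \<le> norm (?y n)" for n
      using C by (simp add: backward_shift_def seq_scale_def norm_mult mult_right_mono)
    with y show ?thesis using solid_mem solid_le by metis
  qed
  then show ?thesis
    unfolding bounded_operator_on_def
    by (auto simp: backward_shift_def seq_scale_def fun_eq_iff algebra_simps)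
qed

text \<open>Treats the iterates of both shifts together: \<open>f k\<close> lives on the image under
  \<open>\<sigma> k\<close> of the support of \<open>x\<close>, so its norm is at most a fixed
  finite combination of the coefficients \<open>c k m\<close>, each summable in
  \<open>k\<close>.\<close>

lemma unconditionally_convergent_translates:
  assumes x: "x \<in> finite_support" and inj: "\<And>k. inj (\<sigma> k)"
    and f: "\<And>k m. f k (\<sigma> k m) = c k m * x m" and surj: "\<And>k. surj (\<sigma> k)"
    and sm: "\<And>m. summable (\<lambda>k. norm (c k m))"
  shows "unconditionally_convergent V N f"
proof -
  define F where "F = {n. x n \<noteq> 0}"
  have F: "finite F" using x by (simp add: F_def finite_support_def)
  have *: "f k \<in> V \<and> N (f k) \<le> (\<Sum>m\<in>F. norm (c k m) * norm (x m))" for k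
  proof -
    have "f k n = 0" if "n \<notin> \<sigma> k ` F" for n
    proof -
      obtain m where "n = \<sigma> k m" using surj[of k] by blast
      with that show ?thesis by (auto simp: f F_def)
    qed
    then have "f k \<in> V \<and> N (f k) \<le> (\<Sum>n\<in>\<sigma> k ` F. norm (f k n))"
      using F by (intro finite_support_mem_le) auto
    also have "(\<Sum>n\<in>\<sigma> k ` F. norm (f k n)) = (\<Sum>m\<in>F. norm (c k m) * norm (x m))"
      using inj[of k] by (subst sum.reindex) (auto simp: f norm_mult intro: inj_on_subset)
    finally show ?thesis .
  qed
  have "summable (\<lambda>k. \<Sum>m\<in>F. norm (c k m) * norm (x m))"
    by (intro summable_sum summable_mult2 sm)
  then have "summable (\<lambda>k. N (f k))"
    by (rule summable_comparison_test_ev[rotated]) (use * N_nonneg in auto)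
  with * show ?thesis by (intro unconditionally_convergentI complete) auto
qed

lemma backward_shift_criterion:
  assumes bdd: "bounded (range w)" and nz: "\<And>n. w n \<noteq> 0"
    and neg: "\<And>m. summable (\<lambda>k. norm (\<Prod>i<k. w (m - int i)))"
    and pos: "\<And>m. summable (\<lambda>k. norm (\<Prod>i<k. inverse (w (m + int i))))"
  shows "frequent_hypercyclicity_criterion seq_scale V N (backward_shift w)"
  unfolding frequent_hypercyclicity_criterion_def
proof (intro conjI exI ballI)
  \<comment> \<open>The witnesses are still schematic here; the statements shown below fix them as
    \<open>finite_support\<close> and \<open>forward_shift w\<close>.\<close>
  fix y :: "int \<Rightarrow> 'a" assume y: "y \<in> finite_support"
  show "unconditionally_convergent V N (\<lambda>k. (backward_shift w ^^ k) y)"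
  proof (rule unconditionally_convergent_translates[OF y,
        where \<sigma> = "\<lambda>k m. m - int k" and c = "\<lambda>k m. \<Prod>i<k. w (m - int i)"])
    show "surj (\<lambda>m. m - int k)" for k by (rule surjI[of _ "\<lambda>m. m + int k"]) simp
  qed (auto simp: inj_on_def backward_shift_funpow neg)
  show "unconditionally_convergent V N (\<lambda>k. (forward_shift w ^^ k) y)"
  proof (rule unconditionally_convergent_translates[OF y,
        where \<sigma> = "\<lambda>k m. m + int k" and c = "\<lambda>k m. \<Prod>i<k. inverse (w (m + 1 + int i))"])
    show "surj (\<lambda>m. m + int k)" for k by (rule surjI[of _ "\<lambda>m. m - int k"]) simp
  qed (auto simp: inj_on_def forward_shift_funpow pos)
  show "backward_shift w (forward_shift w y) = y"
    using nz by (simp add: backward_shift_def forward_shift_def fun_eq_iff)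
qed (use separable_banach bounded_operator_backward_shift[OF bdd] finite_support_subset
    finite_support_dense forward_shift_finite_support in auto)

end

subsection \<open>The space \<open>\<ell>\<^sub>p\<close>\<close>

text \<open>Convexity is applied to positive \<open>s\<close> and \<open>t\<close>. If one of them
  is 0, the claim reduces to \<open>c powr p \<le> c\<close> for
  \<open>0 < c \<le> 1\<close>.\<close>

lemma powr_convex_nonneg:
  fixes s t u v p :: real
  assumes "1 \<le> p" "0 \<le> s" "0 \<le> t" "0 < u" "0 < v" "u + v = 1"
  shows "(u * s + v * t) powr p \<le> u * s powr p + v * t powr p"
proof -
  have scaled: "(c * r) powr p \<le> c * r powr p" if "0 < c" "c \<le> 1" "0 \<le> r" for c r :: real
  proof -
    have "c powr p \<le> c powr 1" using that assms(1) by (intro powr_mono') auto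
    then show ?thesis using that by (simp add: powr_mult mult_right_mono)
  qed
  have "u = 1 - v" using assms by simp
  show ?thesis
  proof (cases "s = 0 \<or> t = 0")
    case True
    then show ?thesis using scaled[of u s] scaled[of v t] assms by auto
  next
    case False
    then show ?thesis
      using convex_onD[OF powr_convex[OF assms(1)], of v s t] assms \<open>u = 1 - v\<close> by simp
  qed
qed

context
  fixes p :: real
  assumes p: "1 \<le> p"
begin

lemma lp_norm_nonneg: "0 \<le> lp_norm p x"
  by (simp add: lp_norm_def)

lemma lp_norm_powr: "lp_norm p x powr p = (\<Sum>\<^sub>\<infinity>n. norm (x n) powr p)"
  using p by (simp add: lp_norm_def powr_powr infsum_nonneg)

lemma lp_norm_leI:
  assumes "0 \<le> C" "(\<Sum>\<^sub>\<infinity>n. norm (x n) powr p) \<le> C powr p"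
  shows "lp_norm p x \<le> C"
  using assms p powr_mono2[of "1 / p" "\<Sum>\<^sub>\<infinity>n. norm (x n) powr p" "C powr p"]
  by (simp add: lp_norm_def powr_powr infsum_nonneg)

lemma lp_norm_eq_0_iff:
  fixes x :: "int \<Rightarrow> 'a::real_normed_field"
  assumes "x \<in> lp_space p"
  shows "lp_norm p x = 0 \<longleftrightarrow> x = 0"
proof
  assume "lp_norm p x = 0"
  then have "(\<Sum>\<^sub>\<infinity>n. norm (x n) powr p) \<le> 0"
    using lp_norm_powr[of x] p by simp
  then have "norm (x n) powr p = 0" for n
    using assms unfolding lp_space_def by (intro nonneg_infsum_le_0D) auto
  then show "x = 0" by (auto simp: fun_eq_iff)
next
  assume "x = 0"
  then show "lp_norm p x = 0" using p by (simp add: lp_norm_def)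
qed

lemma lp_solid_mem:
  assumes "x \<in> lp_space p" "\<And>n. norm (y n) \<le> norm (x n)"
  shows "y \<in> lp_space p"
  using assms p unfolding lp_space_def mem_Collect_eq
  by (elim summable_on_comparison_test) (auto intro!: powr_mono2)

lemma lp_solid_le:
  assumes "x \<in> lp_space p" "\<And>n. norm (y n) \<le> norm (x n)"
  shows "lp_norm p y \<le> lp_norm p x"
proof (rule lp_norm_leI[OF lp_norm_nonneg])
  show "(\<Sum>\<^sub>\<infinity>n. norm (y n) powr p) \<le> lp_norm p x powr p"
    unfolding lp_norm_powr using assms p lp_solid_mem[OF assms]
    by (intro infsum_mono) (auto simp: lp_space_def intro!: powr_mono2)
qed

lemma lp_scale:
  assumes "x \<in> lp_space p"
  shows "seq_scale c x \<in> lp_space p" "lp_norm p (seq_scale c x) = norm c * lp_norm p x"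
proof -
  have *: "norm (seq_scale c x n) powr p = norm c powr p * norm (x n) powr p" for n
    by (simp add: seq_scale_def norm_mult powr_mult)
  show "seq_scale c x \<in> lp_space p"
    using assms by (simp add: lp_space_def * summable_on_cmult_right)
  show "lp_norm p (seq_scale c x) = norm c * lp_norm p x"
    using p by (simp add: lp_norm_def * infsum_cmult_right' powr_mult powr_powr infsum_nonneg)
qed

text \<open>Convexity at the midpoint bounds the powers of the sum by a multiple of the summed
  powers.\<close>

lemma lp_add_mem:
  assumes "x \<in> lp_space p" "y \<in> lp_space p"
  shows "x + y \<in> lp_space p"
proof -
  have "(\<lambda>n. 2 powr p * (1/2 * norm (x n) powr p + 1/2 * norm (y n) powr p)) summable_on UNIV"
    using assms unfolding lp_space_def
    by (intro summable_on_cmult_right summable_on_add) auto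
  moreover have "norm ((x + y) n) powr p \<le> 2 powr p * (1/2 * norm (x n) powr p + 1/2 * norm (y n) powr p)" for n
  proof -
    have "norm ((x + y) n) powr p \<le> (norm (x n) + norm (y n)) powr p"
      using p by (intro powr_mono2) (auto simp: norm_triangle_ineq)
    also have "norm (x n) + norm (y n) = 2 * (1/2 * norm (x n) + 1/2 * norm (y n))" by simp
    also have "\<dots> powr p = 2 powr p * (1/2 * norm (x n) + 1/2 * norm (y n)) powr p"
      by (rule powr_mult)
    also have "\<dots> \<le> 2 powr p * (1/2 * norm (x n) powr p + 1/2 * norm (y n) powr p)"
      by (intro mult_left_mono powr_convex_nonneg p) auto
    finally show ?thesis .
  qed
  ultimately show ?thesis
    unfolding lp_space_def mem_Collect_eq by (rule summable_on_comparison_test) auto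
qed

text \<open>Minkowski's inequality by convexity: after scaling both sequences to norm 1, the
  normalized sum is a convex combination with weights \<open>a / (a + b)\<close> and
  \<open>b / (a + b)\<close>. A sequence of norm 0 cannot be scaled, but it is the zero
  sequence.\<close>

lemma lp_minkowski:
  fixes x y :: "int \<Rightarrow> 'a::real_normed_field"
  assumes x: "x \<in> lp_space p" and y: "y \<in> lp_space p"
  shows "lp_norm p (x + y) \<le> lp_norm p x + lp_norm p y"
proof -
  define a b where "a = lp_norm p x" and "b = lp_norm p y"
  show ?thesis
  proof (cases "a = 0 \<or> b = 0")
    case True
    then show ?thesis using x y by (auto simp: a_def b_def lp_norm_eq_0_iff lp_norm_nonneg)
  next
    case False
    then have ab: "0 < a" "0 < b" by (auto simp: a_def b_def less_le lp_norm_nonneg)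
    define f where "f n = (a + b) powr p *
      (a / (a + b) * (norm (x n) / a) powr p + b / (a + b) * (norm (y n) / b) powr p)" for n
    have *: "(\<lambda>n. (norm (z n) / c) powr p) summable_on UNIV \<and> (\<Sum>\<^sub>\<infinity>n. (norm (z n) / c) powr p) = 1"
      if "z \<in> lp_space p" "c = lp_norm p z" "0 < c" for z :: "int \<Rightarrow> 'a" and c
    proof -
      have eq: "(\<lambda>n. (norm (z n) / c) powr p) = (\<lambda>n. norm (z n) powr p * inverse (c powr p))"
        by (simp add: divide_inverse powr_mult inverse_powr)
      show ?thesis
        using that lp_norm_powr[of z, symmetric] unfolding eq lp_space_def
        by (simp add: summable_on_cmult_left infsum_cmult_left')
    qed
    have sx: "((\<lambda>n. (norm (x n) / a) powr p) has_sum 1) UNIV"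
      and sy: "((\<lambda>n. (norm (y n) / b) powr p) has_sum 1) UNIV"
      using *[OF x a_def ab(1)] *[OF y b_def ab(2)] has_sum_infsum by fastforce+
    have sf: "(f has_sum ((a + b) powr p * (a / (a + b) * 1 + b / (a + b) * 1))) UNIV"
      unfolding f_def by (intro has_sum_cmult_right has_sum_add sx sy)
    have le: "norm ((x + y) n) powr p \<le> f n" for n
    proof -
      have "norm ((x + y) n) powr p \<le> (norm (x n) + norm (y n)) powr p"
        using p by (intro powr_mono2) (auto simp: norm_triangle_ineq)
      also have "norm (x n) + norm (y n)
          = (a + b) * (a / (a + b) * (norm (x n) / a) + b / (a + b) * (norm (y n) / b))"
        using ab by (simp add: add_divide_distrib[symmetric])
      also have "\<dots> powr p = (a + b) powr p *
          (a / (a + b) * (norm (x n) / a) + b / (a + b) * (norm (y n) / b)) powr p"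
        by (rule powr_mult)
      also have "\<dots> \<le> f n"
        unfolding f_def using ab
        by (intro mult_left_mono powr_convex_nonneg p) (auto simp: add_divide_distrib[symmetric])
      finally show ?thesis .
    qed
    show ?thesis
      unfolding a_def[symmetric] b_def[symmetric]
    proof (rule lp_norm_leI)
      have "(\<Sum>\<^sub>\<infinity>n. norm ((x + y) n) powr p) \<le> (a + b) powr p * (a / (a + b) * 1 + b / (a + b) * 1)"
        using lp_add_mem[OF x y] le
        by (intro has_sum_mono[OF has_sum_infsum sf]) (auto simp: lp_space_def)
      also have "\<dots> = (a + b) powr p"
        using ab by (simp add: add_divide_distrib[symmetric])
      finally show "(\<Sum>\<^sub>\<infinity>n. norm ((x + y) n) powr p) \<le> (a + b) powr p" .
    qed (use ab in simp)
  qed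
qed

lemma lp_small_tail:
  assumes x: "x \<in> lp_space p" and e: "0 < e"
  shows "\<exists>F. finite F \<and> lp_norm p (restrict_seq (- F) x) < e"
proof -
  let ?f = "\<lambda>n. norm (x n) powr p"
  have f: "?f summable_on UNIV" using x by (simp add: lp_space_def)
  \<comment> \<open>The error \<open>(e / 2) powr p\<close> becomes \<open>e / 2\<close> after
    taking the root, which leaves room for the strict inequality.\<close>
  obtain F where F: "finite F" "dist (sum ?f F) (infsum ?f UNIV) \<le> (e / 2) powr p"
    using infsum_finite_approximation[OF f, of "(e / 2) powr p"] e by auto
  have "infsum ?f (- F) = infsum ?f UNIV - sum ?f F"
    using infsum_Diff[OF f, of F] F(1) by (simp add: Compl_eq_Diff_UNIV)
  then have "infsum ?f (- F) \<le> (e / 2) powr p"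
    using F(2) by (simp add: dist_real_def)
  also have "infsum ?f (- F) = (\<Sum>\<^sub>\<infinity>n. norm (restrict_seq (- F) x n) powr p)"
    using p by (intro infsum_cong_neutral) (auto simp: restrict_seq_def)
  finally have "lp_norm p (restrict_seq (- F) x) \<le> e / 2"
    using e by (intro lp_norm_leI) auto
  with F(1) e show ?thesis by (intro exI[of _ F]) auto
qed

text \<open>Already \<open>e = 1\<close> decides: the finite partial sums of the powers of
  \<open>x - y\<close> are bounded by 1, so \<open>x - y\<close> is in the space, and
  \<open>y\<close> is added back.\<close>

lemma lp_closed_mem:
  fixes x :: "int \<Rightarrow> 'a::real_normed_field"
  assumes "\<And>e. 0 < e \<Longrightarrow> \<exists>y\<in>lp_space p. \<forall>F. finite F \<longrightarrow> lp_norm p (restrict_seq F (x - y)) \<le> e"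
  shows "x \<in> lp_space p"
proof -
  obtain y where y: "y \<in> lp_space p" "\<And>F. finite F \<Longrightarrow> lp_norm p (restrict_seq F (x - y)) \<le> 1"
    using assms[of 1] by auto
  have "(\<Sum>n\<in>F. norm ((x - y) n) powr p) \<le> 1" if "finite F" for F
  proof -
    have "(\<Sum>n\<in>F. norm ((x - y) n) powr p) = (\<Sum>\<^sub>\<infinity>n\<in>F. norm ((x - y) n) powr p)"
      using that by simp
    also have "\<dots> = (\<Sum>\<^sub>\<infinity>n. norm (restrict_seq F (x - y) n) powr p)"
      using p by (intro infsum_cong_neutral) (auto simp: restrict_seq_def)
    also have "\<dots> = lp_norm p (restrict_seq F (x - y)) powr p"
      by (rule lp_norm_powr[symmetric])
    also have "\<dots> \<le> 1"
      using powr_mono2[OF _ lp_norm_nonneg y(2)[OF that], of p] p by simp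
    finally show ?thesis .
  qed
  then have "x - y \<in> lp_space p"
    unfolding lp_space_def mem_Collect_eq
    by (intro nonneg_bdd_above_summable_on bdd_aboveI[of _ 1]) auto
  from lp_add_mem[OF this y(1)] show ?thesis by simp
qed

lemma lp_translate:
  assumes "x \<in> lp_space p"
  shows "(\<lambda>n. x (n + 1)) \<in> lp_space p" "lp_norm p (\<lambda>n. x (n + 1)) = lp_norm p x"
proof -
  have bij: "bij_betw (\<lambda>n::int. n + 1) UNIV UNIV"
    by (rule bij_betwI[of _ _ _ "\<lambda>n. n - 1"]) auto
  show "(\<lambda>n. x (n + 1)) \<in> lp_space p"
    using assms summable_on_reindex_bij_betw[OF bij, of "\<lambda>n. norm (x n) powr p"]
    by (simp add: lp_space_def)
  show "lp_norm p (\<lambda>n. x (n + 1)) = lp_norm p x"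
    using infsum_reindex_bij_betw[OF bij, of "\<lambda>n. norm (x n) powr p"]
    by (simp add: lp_norm_def)
qed

lemma lp_unit:
  fixes m :: int
  defines "u \<equiv> unit_seq m :: int \<Rightarrow> 'a::real_normed_field"
  shows "u \<in> lp_space p" "lp_norm p u = 1"
proof -
  have "((\<lambda>n. norm (u n) powr p) has_sum 1) {m}"
    by (rule has_sum_finiteI) (auto simp: u_def unit_seq_def)
  then have "((\<lambda>n. norm (u n) powr p) has_sum 1) UNIV"
    using p by (subst has_sum_cong_neutral[of "{m}"]) (auto simp: u_def unit_seq_def)
  then show "u \<in> lp_space p" "lp_norm p u = 1"
    by (auto simp: lp_space_def lp_norm_def infsumI has_sum_imp_summable)
qed

end

lemma vector_space_seq_scale: "vector_space (seq_scale :: 'a::field \<Rightarrow> _)"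
  by standard (auto simp: seq_scale_def fun_eq_iff algebra_simps)

lemma lp_solid_sequence_space:
  assumes p: "1 \<le> p"
  shows "solid_sequence_space (lp_space p :: (int \<Rightarrow> 'a::{real_normed_field, euclidean_space}) set) (lp_norm p)"
proof -
  interpret vector_space "seq_scale :: 'a \<Rightarrow> _" by (rule vector_space_seq_scale)
  have "subspace (lp_space p :: (int \<Rightarrow> 'a) set)"
    using lp_add_mem[OF p] lp_scale(1)[OF p] p by (intro subspaceI) (auto simp: lp_space_def)
  then show ?thesis
    using p by unfold_locales
      (auto simp: lp_norm_nonneg lp_norm_eq_0_iff lp_scale lp_unit lp_translate
        intro: lp_minkowski lp_solid_mem lp_solid_le lp_small_tail lp_closed_mem)
qed

subsection \<open>The space \<open>c\<^sub>0\<close>\<close>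

text \<open>A set of integers is finite exactly when it avoids all \<open>n\<close> of large
  absolute value, so the filter turns into finiteness of level sets.\<close>

lemma c0_space_iff: "x \<in> c0_space \<longleftrightarrow> (\<forall>e>0. finite {n. e \<le> norm (x n)})"
proof -
  have fin: "finite A \<longleftrightarrow> (\<exists>K. \<forall>n. K \<le> \<bar>n\<bar> \<longrightarrow> n \<notin> A)" for A :: "int set"
  proof
    assume "finite A"
    then have "bdd_above (abs ` A)" by simp
    then obtain K where "\<And>n. n \<in> A \<Longrightarrow> \<bar>n\<bar> \<le> K"
      by (auto simp: bdd_above_def)
    then show "\<exists>K. \<forall>n. K \<le> \<bar>n\<bar> \<longrightarrow> n \<notin> A" by (intro exI[of _ "K + 1"]) force
  next
    assume "\<exists>K. \<forall>n. K \<le> \<bar>n\<bar> \<longrightarrow> n \<notin> A"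
    then obtain K where "\<forall>n. K \<le> \<bar>n\<bar> \<longrightarrow> n \<notin> A" by blast
    then have "\<bar>n\<bar> < K" if "n \<in> A" for n using that not_le by blast
    then have "A \<subseteq> {-K..K}" by (fastforce simp: abs_less_iff)
    then show "finite A" using finite_subset by blast
  qed
  show ?thesis
    unfolding c0_space_def mem_Collect_eq tendsto_iff eventually_filtercomap_at_top_linorder fin
    by (auto simp: not_le)
qed

text \<open>The point is that the supremum is taken over a bounded set: only finitely many
  coordinates have norm at least 1.\<close>

lemma c0_norm_coord_le:
  assumes "x \<in> c0_space"
  shows "norm (x n) \<le> c0_norm x"
proof -
  have "finite {n. 1 \<le> norm (x n)}" using assms by (simp add: c0_space_iff)
  then have "bdd_above ((\<lambda>n. norm (x n)) ` {n. 1 \<le> norm (x n)})" by simp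
  then obtain C where "\<forall>n. 1 \<le> norm (x n) \<longrightarrow> norm (x n) \<le> C"
    by (auto simp: bdd_above_def)
  then have "norm (x n) \<le> max C 1" for n by (cases "1 \<le> norm (x n)") auto
  then have "bdd_above (range (\<lambda>n. norm (x n)))" by (auto intro!: bdd_aboveI)
  then show ?thesis unfolding c0_norm_def by (rule cSUP_upper[OF UNIV_I])
qed

lemma c0_norm_leI: "(\<And>n. norm (x n) \<le> C) \<Longrightarrow> c0_norm x \<le> C"
  unfolding c0_norm_def by (rule cSUP_least) auto

lemma c0_norm_nonneg: "x \<in> c0_space \<Longrightarrow> 0 \<le> c0_norm x"
  by (rule order_trans[OF norm_ge_zero c0_norm_coord_le])

lemma c0_solid_mem:
  assumes "x \<in> c0_space" "\<And>n. norm (y n) \<le> norm (x n)"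
  shows "y \<in> c0_space"
  unfolding c0_space_iff
proof (intro allI impI)
  fix e :: real assume "0 < e"
  then have "finite {n. e \<le> norm (x n)}" using assms(1) by (simp add: c0_space_iff)
  then show "finite {n. e \<le> norm (y n)}"
    by (rule rev_finite_subset) (auto intro: order_trans[OF _ assms(2)])
qed

lemma c0_add_mem: "x \<in> c0_space \<Longrightarrow> y \<in> c0_space \<Longrightarrow> x + y \<in> c0_space"
  unfolding c0_space_def plus_fun_def using tendsto_add_zero by auto

lemma c0_scale:
  assumes "x \<in> c0_space"
  shows "seq_scale c x \<in> c0_space" "c0_norm (seq_scale c x) = norm c * c0_norm x"
proof -
  show m: "seq_scale c x \<in> c0_space"
    using assms unfolding c0_space_def seq_scale_def by (auto intro: tendsto_mult_right_zero)
  show "c0_norm (seq_scale c x) = norm c * c0_norm x"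
  proof (rule antisym)
    show "c0_norm (seq_scale c x) \<le> norm c * c0_norm x"
      by (intro c0_norm_leI) (simp add: seq_scale_def norm_mult mult_left_mono c0_norm_coord_le assms)
    show "norm c * c0_norm x \<le> c0_norm (seq_scale c x)"
    proof (cases "c = 0")
      case False
      have "c0_norm x \<le> c0_norm (seq_scale c x) / norm c"
        using c0_norm_coord_le[OF m] False
        by (intro c0_norm_leI) (simp add: seq_scale_def norm_mult field_simps)
      then show ?thesis using False by (simp add: field_simps)
    qed (use c0_norm_nonneg[OF m] in simp)
  qed
qed

text \<open>Singletons \<open>F\<close> make \<open>x\<close> uniformly \<open>e / 3\<close>-close
  to \<open>y\<close>, so coordinates where \<open>x\<close> reaches \<open>e\<close> are among the
  finitely many where \<open>y\<close> reaches \<open>e / 3\<close>. Unlike in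
  \<open>lp_closed_mem\<close>, every \<open>e\<close> is used.\<close>

lemma c0_closed_mem:
  fixes x :: "int \<Rightarrow> 'a::real_normed_field"
  assumes "\<And>e. 0 < e \<Longrightarrow> \<exists>y\<in>c0_space. \<forall>F. finite F \<longrightarrow> c0_norm (restrict_seq F (x - y)) \<le> e"
  shows "x \<in> c0_space"
  unfolding c0_space_iff
proof (intro allI impI)
  fix e :: real assume e: "0 < e"
  then obtain y where y: "y \<in> c0_space" "\<And>F. finite F \<Longrightarrow> c0_norm (restrict_seq F (x - y)) \<le> e / 3"
    using assms[of "e / 3"] by auto
  have "norm (x n - y n) \<le> e / 3" for n
  proof -
    have "restrict_seq {n} (x - y) \<in> c0_space"
      unfolding c0_space_iff restrict_seq_def by (auto intro: finite_subset[of _ "{n}"])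
    from c0_norm_coord_le[OF this, of n] y(2)[of "{n}"] show ?thesis
      by (simp add: restrict_seq_def)
  qed
  moreover have "norm (x n) \<le> norm (x n - y n) + norm (y n)" for n
    using norm_triangle_ineq[of "x n - y n" "y n"] by simp
  ultimately have "norm (x n) \<le> e / 3 + norm (y n)" for n
    by (meson add_right_mono order_trans)
  then have "e / 3 \<le> norm (y n)" if "e \<le> norm (x n)" for n
    using order_trans[OF that] e by fastforce
  then have "{n. e \<le> norm (x n)} \<subseteq> {n. e / 3 \<le> norm (y n)}" by auto
  then show "finite {n. e \<le> norm (x n)}"
    using y(1) e finite_subset unfolding c0_space_iff by (metis zero_less_divide_iff zero_less_numeral)
qed

lemma c0_small_tail:
  assumes "x \<in> c0_space" "0 < e"
  shows "\<exists>F. finite F \<and> c0_norm (restrict_seq (- F) x) < e"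
proof (intro exI conjI)
  show "finite {n. e / 2 \<le> norm (x n)}"
    using assms by (simp add: c0_space_iff del: divide_le_eq_numeral1 divide_le_eq_numeral)
  have "c0_norm (restrict_seq (- {n. e / 2 \<le> norm (x n)}) x) \<le> e / 2"
    using assms(2) by (intro c0_norm_leI) (auto simp: restrict_seq_def)
  then show "c0_norm (restrict_seq (- {n. e / 2 \<le> norm (x n)}) x) < e" using assms(2) by simp
qed

lemma c0_translate:
  assumes "x \<in> c0_space"
  shows "(\<lambda>n. x (n + 1)) \<in> c0_space" "c0_norm (\<lambda>n. x (n + 1)) = c0_norm x"
proof -
  have "{n. e \<le> norm (x (n + 1))} = (\<lambda>n. n - 1) ` {n. e \<le> norm (x n)}" for e
    by (auto simp: image_iff intro!: exI[of _ "_ + 1"])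
  then show "(\<lambda>n. x (n + 1)) \<in> c0_space" using assms by (simp add: c0_space_iff)
  have "range (\<lambda>n. norm (x (n + 1))) = (\<lambda>n. norm (x n)) ` range (\<lambda>n. n + 1)"
    by (simp only: image_image)
  also have "range (\<lambda>n::int. n + 1) = UNIV" by (rule surjI[of _ "\<lambda>n. n - 1"]) simp
  finally show "c0_norm (\<lambda>n. x (n + 1)) = c0_norm x" by (simp add: c0_norm_def)
qed

lemma c0_unit:
  fixes m :: int
  defines "u \<equiv> unit_seq m :: int \<Rightarrow> 'a::real_normed_field"
  shows "u \<in> c0_space" "c0_norm u = 1"
proof -
  show u: "u \<in> c0_space"
    unfolding c0_space_iff u_def unit_seq_def by (auto intro: finite_subset[of _ "{m}"])
  show "c0_norm u = 1"
    using c0_norm_coord_le[OF u, of m]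
    by (intro antisym c0_norm_leI) (auto simp: u_def unit_seq_def)
qed

lemma c0_solid_sequence_space:
  "solid_sequence_space (c0_space :: (int \<Rightarrow> 'a::{real_normed_field, euclidean_space}) set) c0_norm"
proof -
  interpret vector_space "seq_scale :: 'a \<Rightarrow> _" by (rule vector_space_seq_scale)
  have "(0 :: int \<Rightarrow> 'a) \<in> c0_space"
    by (simp add: c0_space_def zero_fun_def)
  then have "subspace (c0_space :: (int \<Rightarrow> 'a) set)"
    using c0_add_mem c0_scale(1) by (intro subspaceI) auto
  moreover have "c0_norm x = 0 \<longleftrightarrow> x = 0" if "x \<in> c0_space" for x :: "int \<Rightarrow> 'a"
    using c0_norm_coord_le[OF that] by (auto simp: fun_eq_iff c0_norm_def)
  moreover have "c0_norm (x + y) \<le> c0_norm x + c0_norm y"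
    if "x \<in> c0_space" "y \<in> c0_space" for x y :: "int \<Rightarrow> 'a"
    using that by (intro c0_norm_leI) (auto intro!: norm_triangle_mono c0_norm_coord_le)
  moreover have "c0_norm y \<le> c0_norm x"
    if "x \<in> c0_space" "\<And>n. norm (y n) \<le> norm (x n)" for x y :: "int \<Rightarrow> 'a"
    by (intro c0_norm_leI order_trans[OF that(2) c0_norm_coord_le[OF that(1)]])
  ultimately show ?thesis
    by unfold_locales
      (auto simp: c0_norm_nonneg c0_scale c0_unit c0_translate
        intro: c0_solid_mem c0_small_tail c0_closed_mem)
qed

subsection \<open>The criterion for \<open>B\<^sub>w\<close>\<close>

text \<open>The sort of \<open>'a\<close> describes the real and the complex field. The value at
  \<open>n = 0\<close>, where the exponent is 0 by division by zero, does not influence the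
  limits.\<close>

theorem mainTheorem6:
  fixes w :: "int \<Rightarrow> 'a::{real_normed_field, euclidean_space}"
  assumes "bounded (range w)"
    and "(INF n. norm (w n)) > 0"
    and "\<exists>L<1. (\<lambda>n. SUP k\<in>{1..}. norm (\<Prod>j=0..n. w (- int k - int j)) powr (1 / real n))
           \<longlonglongrightarrow> L"
    and "\<exists>L>1. (\<lambda>n. INF k\<in>{1..}. norm (\<Prod>j=0..n. w (int k + int j)) powr (1 / real n))
           \<longlonglongrightarrow> L"
  shows "(\<forall>p\<ge>1. frequent_hypercyclicity_criterion seq_scale (lp_space p) (lp_norm p) (backward_shift w))
       \<and> frequent_hypercyclicity_criterion seq_scale c0_space c0_norm (backward_shift w)"
proof -
  obtain C where C: "0 < C" "\<And>n. norm (w n) \<le> C"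
    using assms(1) unfolding bounded_pos by auto
  have nz: "w n \<noteq> 0" for n
  proof -
    have "(INF n. norm (w n)) \<le> norm (w n)"
      by (rule cINF_lower) (auto intro!: bdd_belowI[of _ 0])
    with assms(2) show ?thesis by auto
  qed
  have "summable (\<lambda>n. norm (\<Prod>j=0..n. w (- int 1 - int j)))"
  proof -
    obtain L where "L < 1"
      "(\<lambda>n. SUP k\<in>{1..}. norm (\<Prod>j=0..n. w (- int k - int j)) powr (1 / real n)) \<longlonglongrightarrow> L"
      using assms(3) by blast
    moreover have "norm (\<Prod>j=0..n. w (- int 1 - int j)) powr (1 / real n)
        \<le> (SUP k\<in>{1..}. norm (\<Prod>j=0..n. w (- int k - int j)) powr (1 / real n))" for n
    proof (rule cSUP_upper)
      \<comment> \<open>A real supremum dominates its terms only over a bounded family; each of the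
        \<open>n + 1\<close> factors is at most \<open>C\<close>.\<close>
      have "norm (\<Prod>j=0..n. w (- int k - int j)) \<le> C ^ Suc n" for k
        using prod_mono[of "{0..n}" "\<lambda>j. norm (w (- int k - int j))" "\<lambda>_. C"] C(2)
        by (simp add: prod_norm)
      then show "bdd_above ((\<lambda>k. norm (\<Prod>j=0..n. w (- int k - int j)) powr (1 / real n)) ` {1..})"
        by (intro bdd_aboveI[of _ "(C ^ Suc n) powr (1 / real n)"]) (auto intro!: powr_mono2)
    qed simp
    ultimately show ?thesis
      by (intro summable_of_root_limit_less_1) auto
  qed
  \<comment> \<open>The product over \<open>0..n\<close> has \<open>n + 1\<close> factors, so it is
    term \<open>Suc n\<close> of the series of \<open>k\<close>-fold products.\<close>
  then have "summable (\<lambda>n. \<Prod>i<Suc n. norm (w (- (1 + int i))))"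
    by (simp only: atLeast0AtMost lessThan_Suc_atMost prod_norm) (simp add: algebra_simps)
  then have base: "summable (\<lambda>k. \<Prod>i<k. norm (w (- (1 + int i))))"
    by (rule summable_Suc_iff[THEN iffD1])
  \<comment> \<open>Reflecting the weights turns products running left from \<open>m\<close> into
    products running right from \<open>- m\<close>, so the base point -1 becomes 1.\<close>
  have neg: "summable (\<lambda>k. norm (\<Prod>i<k. w (m - int i)))" for m
    using summable_prod_translate[of "\<lambda>n. norm (w (- n))" 1 "- m"] base nz
    by (simp add: prod_norm)
  have "summable (\<lambda>n. inverse (norm (\<Prod>j=0..n. w (int 1 + int j))))"
  proof -
    obtain L where L: "1 < L"
      "(\<lambda>n. INF k\<in>{1..}. norm (\<Prod>j=0..n. w (int k + int j)) powr (1 / real n)) \<longlonglongrightarrow> L"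
      using assms(4) by blast
    have "(INF k\<in>{1..}. norm (\<Prod>j=0..n. w (int k + int j)) powr (1 / real n))
        \<le> norm (\<Prod>j=0..n. w (int 1 + int j)) powr (1 / real n)" for n
      by (rule cINF_lower) (auto intro!: bdd_belowI[of _ 0])
    with L show ?thesis
      by (intro summable_inverse_of_root_limit_greater_1[OF _ _ L(2,1)]) auto
  qed
  then have "summable (\<lambda>n. \<Prod>i<Suc n. inverse (norm (w (1 + int i))))"
    by (simp add: atLeast0AtMost lessThan_Suc_atMost prod_norm[symmetric] prod_inversef[symmetric] comp_def
        del: prod.lessThan_Suc prod.atMost_Suc)
  then have base': "summable (\<lambda>k. \<Prod>i<k. inverse (norm (w (1 + int i))))"
    by (rule summable_Suc_iff[THEN iffD1])
  have pos: "summable (\<lambda>k. norm (\<Prod>i<k. inverse (w (m + int i))))" for m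
    using summable_prod_translate[of "\<lambda>n. inverse (norm (w n))" 1 m] base' nz
    by (simp add: prod_norm[symmetric] norm_inverse)
  show ?thesis
    using solid_sequence_space.backward_shift_criterion[OF _ assms(1) nz neg pos]
      lp_solid_sequence_space c0_solid_sequence_space by blast
qed

end
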